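(* Let $s\geq 3$ be an integer, $m=2s$, $q=2^m$, and let $$\overline{\mathcal{C}_1^{\bot}}^{\bot}=\{(\mathrm{Tr}_1^m(ax^5+bx^3+cx)+h)_{x\in\mathbb{F}_q}: a,b,c\in\mathbb{F}_q,\ h\in\mathbb{F}_2\}.$$ For every $i\ge 1$ such that this code contains a codeword of weight $i$, the supports of the codewords of weight $i$ form the block set of a $2$-design on the set $\mathcal{P}$ of the $2^m$ coordinate positions. Moreover, for each of the following pairs $(i,\lambda)$, the supports of the codewords of weight $i$ form a $2$-$(2^m,i,\lambda)$ design: - $i=2^{2s-1}$, $\lambda=\dfrac{(29\cdot 2^{6s-6}-33\cdot 2^{4s-6}+17\cdot 2^{2s-4}-1)(2^{2s-1}-1)}{2^{2s}-1}$; - $i=2^{2s-1}-2^{s-1}$, $\lambda=\dfrac{2}{15}\cdot\dfrac{2^{s-1}(3\cdot 2^{4s}+5\cdot 2^{2s}-8)(2^{2s-1}-2^{s-1}-1)}{2^s+1}$; - $i=2^{2s-1}+2^{s-1}$, $\lambda=\dfrac{2}{15}\cdot\dfrac{2^{s-1}(3\cdot 2^{4s}+5\cdot 2^{2s}-8)(2^{2s-1}+2^{s-1}-1)}{2^s-1}$; - $i=2^{2s-1}-2^{s}$, $\lambda=\dfrac{7}{3}\cdot 2^{3s-4}(2^{2s-1}-2^s-1)(2^{s-1}-1)$; - $i=2^{2s-1}+2^{s}$, $\lambda=\dfrac{7}{3}\cdot 2^{3s-4}(2^{2s-1}+2^s-1)(2^{s-1}+1)$; - $i=2^{2s-1}-2^{s+1}$,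 $\lambda=\dfrac{1}{15}\cdot\dfrac{2^{s-3}(2^{4s-2}-5\cdot 2^{2s-2}+1)(2^{2s-1}-2^{s+1}-1)(2^{s-2}-1)}{2^{2s}-1}$; - $i=2^{2s-1}+2^{s+1}$, $\lambda=\dfrac{1}{15}\cdot\dfrac{2^{s-3}(2^{4s-2}-5\cdot 2^{2s-2}+1)(2^{2s-1}+2^{s+1}-1)(2^{s-2}+1)}{2^{2s}-1}$.
   Context: $\mathbb{F}_q$ is the finite field with $q=2^m$ elements, and $\mathrm{Tr}_1^m$ is the trace function from $\mathbb{F}_{2^m}$ onto $\mathbb{F}_2$. The coordinate positions of the code are indexed by $\mathbb{F}_q$, identified by a fixed bijection with $\mathcal{P}=\{0,1,\ldots,2^m-1\}$. The support of a codeword is the set of positions where it is nonzero. For $1\le t\le k\le v$, a $t$-$(v,k,\lambda)$ design is a pair $(\mathcal{P},\mathcal{B})$ where $\mathcal{P}$ is a set of $v$ points and $\mathcal{B}$ is a set of $k$-subsets (blocks) of $\mathcal{P}$ such that every $t$-subset of $\mathcal{P}$ is contained in exactly $\lambda$ elements of $\mathcal{B}$; the case $k=v$ is a trivial design. A $t$-design is a $t$-$(v,k,\lambda)$ design for some $v,k,\lambda$. *)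

theory Defs
  imports Complex_Main "HOL-Library.Cardinality"
begin

(* The prime field of order 2 is represented by the subset {0, 1} of the field 'a.
   For CARD('a) = 2 ^ m, trace_F2 m is the absolute trace of 'a, and its values lie in {0, 1}. *)
definition trace_F2 :: "nat \<Rightarrow> 'a::field \<Rightarrow> 'a" where
  "trace_F2 m x = (\<Sum>i<m. x ^ (2 ^ i))"

definition trace_code :: "nat \<Rightarrow> ('a::field \<Rightarrow> 'a) set" where
  "trace_code m =
     {(\<lambda>x. trace_F2 m (a * x ^ 5 + b * x ^ 3 + c * x) + h) | a b c h. h \<in> {0, 1}}"

definition hamming_weight :: "('a \<Rightarrow> 'b::zero) \<Rightarrow> nat" where
  "hamming_weight w = card {x. w x \<noteq> 0}"

(* Codewords are indexed by the field; pos numbers the coordinates. *)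
definition codeword_support :: "('a \<Rightarrow> nat) \<Rightarrow> ('a \<Rightarrow> 'b::zero) \<Rightarrow> nat set" where
  "codeword_support pos w = pos ` {x. w x \<noteq> 0}"

definition supports_of_weight ::
    "('a \<Rightarrow> nat) \<Rightarrow> ('a \<Rightarrow> 'b::zero) set \<Rightarrow> nat \<Rightarrow> nat set set" where
  "supports_of_weight pos C i = codeword_support pos ` {w \<in> C. hamming_weight w = i}"

definition is_design :: "nat \<Rightarrow> nat \<Rightarrow> nat \<Rightarrow> nat \<Rightarrow> 'p set \<Rightarrow> 'p set set \<Rightarrow> bool" where
  "is_design t v k l P B \<longleftrightarrow>
     1 \<le> t \<and> t \<le> k \<and> k \<le> v \<and>
     finite P \<and> card P = v \<and>
     (\<forall>b\<in>B. b \<subseteq> P \<and> card b = k) \<and>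
     (\<forall>T. T \<subseteq> P \<and> card T = t \<longrightarrow> card {b \<in> B. T \<subseteq> b} = l)"

definition is_t_design :: "nat \<Rightarrow> 'p set \<Rightarrow> 'p set set \<Rightarrow> bool" where
  "is_t_design t P B \<longleftrightarrow> (\<exists>v k l. is_design t v k l P B)"

end

theory Submission
  imports Defs "HOL-Computational_Algebra.Polynomial_Factorial"
begin

text \<open>
The code is invariant under the affine maps \<open>x \<mapsto> u x + v\<close> with \<open>u \<noteq> 0\<close>, which act doubly transitively on the
coordinates; hence the codewords of a fixed weight hold \<open>2\<close>-designs, and \<open>\<lambda>\<close> follows from the number of these
codewords by double counting. The weight of a codeword is determined by the exponential sum \<open>W(a,b,c)\<close> of
\<open>(-1)\<^bsup>Tr(ax^5+bx^3+cx)\<^esup>\<close>. Since \<open>ax^5+bx^3\<close> is a quadratic form over the prime field, \<open>W\<^sup>2\<close> is \<open>0\<close> or \<open>q\<close>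
times the size \<open>D\<close> of its radical. The radical is the zero set of a polynomial of degree at most \<open>16\<close>,
so \<open>D \<le> 16\<close>; moreover \<open>D\<close> divides \<open>q = 2\<^bsup>2s\<^esup>\<close>, and \<open>q D\<close> is a square, so \<open>D \<in> {1, 4, 16}\<close>. The
frequencies of the values \<open>0, q, 4q, 16q\<close> of \<open>W\<^sup>2\<close> are the solution of a linear system given by the moments of
orders \<open>0, 2, 4, 6\<close>. The moment of order \<open>2k\<close> counts pairs of \<open>k\<close>-tuples with equal sums of first, third and
fifth powers, and for \<open>k \<le> 3\<close> there are only the trivial ones.
\<close>

subsection \<open>The trace and its additive character\<close>

locale binary_field =
  fixes m :: nat and field_type :: "'a::{field, finite} itself"
  assumes card_field: "CARD('a) = 2 ^ m"
begin

text \<open>Translation by 1 permutes the field, so comparing the sums of \<open>x + 1\<close> and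
  of \<open>x\<close> gives \<open>2 ^ m = 0\<close> in the field.\<close>

lemma two_eq_0 [simp]: "(2::'a) = 0"
proof -
  have "(\<Sum>x\<in>(UNIV::'a set). x + 1) = (\<Sum>x\<in>UNIV. x)"
    by (rule sum.reindex_bij_witness[of _ "\<lambda>x. x - 1" "\<lambda>x. x + 1"]) auto
  then have "(of_nat CARD('a) :: 'a) = 0"
    by (simp add: sum.distrib)
  then show ?thesis
    unfolding card_field by simp
qed

lemma add_self [simp]: "x + x = (0::'a)"
  by (metis mult_2 mult_zero_left two_eq_0)

lemma add_eq_0_iff_eq: "x + y = (0::'a) \<longleftrightarrow> x = y"
  by (metis add_self add_left_cancel)

text \<open>For \<open>x \<noteq> 0\<close>, multiplication by \<open>x\<close> permutes the nonzero
  elements; comparing their products gives \<open>x ^ (2 ^ m - 1) = 1\<close>.\<close>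

lemma power_card [simp]: "x ^ (2 ^ m) = (x::'a)"
proof (cases "x = 0")
  case False
  have "(\<Prod>y\<in>-{0}. y) = (\<Prod>y\<in>-{0}. x * y)"
    by (rule prod.reindex_bij_witness[of _ "\<lambda>y. x * y" "\<lambda>y. y / x"]) (use False in auto)
  also have "\<dots> = x ^ (2 ^ m - 1) * (\<Prod>y\<in>-{0}. y)"
    by (simp add: prod.distrib Compl_eq_Diff_UNIV card_Diff_singleton card_field)
  finally have "x ^ (2 ^ m - 1) = 1"
    by simp
  then show ?thesis
    by (metis mult_1_right power_eq_if power_not_zero zero_neq_numeral)
qed (simp add: power_0_left)

lemma freshman: "(x + y) ^ 2 ^ i = x ^ 2 ^ i + (y::'a) ^ 2 ^ i"
proof (induction i)
  case (Suc i)
  have "(x + y) ^ 2 ^ Suc i = ((x + y) ^ 2 ^ i)\<^sup>2"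
    by (simp add: power_mult[symmetric] mult.commute)
  also have "\<dots> = (x ^ 2 ^ i)\<^sup>2 + (y ^ 2 ^ i)\<^sup>2"
    by (simp add: Suc power2_sum two_eq_0)
  finally show ?case
    by (simp add: power_mult[symmetric] mult.commute)
qed simp

lemmas freshman2 = freshman[of _ _ 1, simplified]

lemma sum_square: "(\<Sum>i\<in>A. f i)\<^sup>2 = (\<Sum>i\<in>A. (f i)\<^sup>2 :: 'a)"
  by (induction A rule: infinite_finite_induct) (simp_all add: freshman2)

text \<open>The map is additive with trivial kernel; finiteness then makes it bijective, which
  supplies the roots in \<open>ex_root\<close>.\<close>

lemma power_two_power_inj: "x ^ 2 ^ i = (y::'a) ^ 2 ^ i \<Longrightarrow> x = y"
  using freshman[of x y i] by (metis add_self add_eq_0_iff_eq power_eq_0_iff)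

lemma power_two_power_bij: "bij (\<lambda>x::'a. x ^ 2 ^ i)"
  by (simp add: bij_def inj_def finite_UNIV_inj_surj power_two_power_inj)

lemma ex_root: "\<exists>y::'a. y ^ 2 ^ i = x"
  using power_two_power_bij[of i] by (metis bij_pointE)

abbreviation Tr :: "'a \<Rightarrow> 'a" where "Tr \<equiv> trace_F2 m"

lemma Tr_0 [simp]: "Tr 0 = 0"
  by (simp add: trace_F2_def power_0_left)

lemma Tr_add: "Tr (x + y) = Tr x + Tr y"
  by (simp add: trace_F2_def freshman sum.distrib)

text \<open>Squaring shifts the summands of the trace cyclically, because
  \<open>x ^ 2 ^ m = x\<close>.\<close>

lemma Tr_square: "Tr (x\<^sup>2) = Tr x"
proof -
  have "Tr x + x ^ 2 ^ m = x + Tr (x\<^sup>2)"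
    using sum.lessThan_Suc[of "\<lambda>i. x ^ 2 ^ i" m] sum.lessThan_Suc_shift[of "\<lambda>i. x ^ 2 ^ i" m]
    by (simp add: trace_F2_def power_mult[symmetric])
  then show ?thesis
    by simp
qed

lemma Tr_power4: "Tr (x ^ 4) = Tr x"
  using Tr_square[of "x\<^sup>2"] Tr_square[of x] by (simp flip: power_mult)

lemma Tr_01: "Tr x \<in> {0, 1}"
proof -
  have "(Tr x)\<^sup>2 = Tr (x\<^sup>2)"
    by (simp add: trace_F2_def sum_square power_mult[symmetric] mult.commute)
  then have "Tr x * (Tr x - 1) = 0"
    unfolding Tr_square by (simp add: power2_eq_square algebra_simps)
  then show ?thesis
    by auto
qed

lemma m_pos: "m > 0"
proof (rule ccontr)
  assume "\<not> m > 0"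
  then have "card (UNIV::'a set) = 1"
    by (simp add: card_field)
  then have "(0::'a) = 1"
    by (metis UNIV_I card_1_singletonE singletonD)
  then show False
    by simp
qed

text \<open>As a polynomial the trace is nonzero of degree at most \<open>2 ^ (m - 1)\<close>, so it
  has fewer than \<open>2 ^ m\<close> roots.\<close>

lemma Tr_nontrivial: "\<exists>x::'a. Tr x = 1"
proof (rule ccontr)
  assume no: "\<nexists>x::'a. Tr x = 1"
  define p where "p = (\<Sum>i<m. monom (1::'a) (2 ^ i))"
  have "coeff p 1 = (\<Sum>i<m. if i = 0 then 1 else 0)"
    unfolding p_def coeff_sum by (rule sum.cong) (auto simp: coeff_monom)
  then have "p \<noteq> 0"
    using m_pos by auto
  moreover have "degree p \<le> 2 ^ (m - 1)"
    unfolding p_def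
    by (rule degree_sum_le) (auto simp: degree_monom_eq intro!: power_increasing)
  moreover have "poly p x = 0" for x
    using no Tr_01[of x] by (auto simp: p_def poly_sum poly_monom trace_F2_def)
  ultimately have "CARD('a) \<le> 2 ^ (m - 1)"
    using card_poly_roots_bound[of p] by simp
  then show False
    using m_pos by (simp add: card_field)
qed

definition chi :: "'a \<Rightarrow> int" where
  "chi x = (if Tr x = 0 then 1 else -1)"

lemma chi_0 [simp]: "chi 0 = 1"
  by (simp add: chi_def)

lemma chi_add: "chi (x + y) = chi x * chi y"
  using Tr_01[of x] Tr_01[of y] by (auto simp: chi_def Tr_add)

lemma chi_cases: "chi x = 1 \<or> chi x = -1"
  by (simp add: chi_def)

lemma chi_square [simp]: "chi x * chi x = 1"
  by (simp add: chi_def)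

text \<open>Translation by an element of trace 1 preserves the sum and negates it.\<close>

lemma sum_chi_UNIV: "(\<Sum>x\<in>UNIV. chi x) = 0"
proof -
  obtain z where z: "Tr z = 1"
    using Tr_nontrivial by blast
  have "(\<Sum>x\<in>UNIV. chi (x + z)) = (\<Sum>x\<in>UNIV. chi x)"
    by (rule sum.reindex_bij_witness[of _ "\<lambda>x. x - z" "\<lambda>x. x + z"]) auto
  moreover have "chi z = -1"
    by (simp add: chi_def z)
  ultimately show ?thesis
    by (simp add: chi_add sum_negf)
qed

lemma sum_chi_mult: "(\<Sum>x\<in>UNIV. chi (x * y)) = (if y = 0 then 2 ^ m else 0)"
proof (cases "y = 0")
  case True
  then show ?thesis
    by (simp add: card_field)
next
  case False
  then have "(\<Sum>x\<in>UNIV. chi (x * y)) = (\<Sum>x\<in>UNIV. chi x)"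
    by (intro sum.reindex_bij_witness[of _ "\<lambda>x. x / y" "\<lambda>x. x * y"]) auto
  with False show ?thesis
    by (simp add: sum_chi_UNIV)
qed

subsection \<open>Values of the Walsh transform\<close>

definition cw :: "'a \<Rightarrow> 'a \<Rightarrow> 'a \<Rightarrow> 'a \<Rightarrow> 'a" where
  "cw a b c x = a * x ^ 5 + b * x ^ 3 + c * x"

definition walsh :: "'a \<Rightarrow> 'a \<Rightarrow> 'a \<Rightarrow> int" where
  "walsh a b c = (\<Sum>x\<in>UNIV. chi (cw a b c x))"

text \<open>The radical of the bilinear form \<open>Tr (f (x + z) - f x - f z)\<close> for \<open>f = cw a b c\<close>. The defining equation
  arises by applying \<open>Tr y\<^sup>2 = Tr y\<close> until all terms have the common factor \<open>x ^ 4\<close>.\<close>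

definition rad :: "'a \<Rightarrow> 'a \<Rightarrow> 'a set" where
  "rad a b = {z. a * z + b\<^sup>2 * z\<^sup>2 + b ^ 4 * z ^ 8 + a ^ 4 * z ^ 16 = 0}"

lemma add_power3: "(x + z) ^ 3 = x ^ 3 + x\<^sup>2 * z + x * z\<^sup>2 + (z::'a) ^ 3"
proof -
  have "(x + z) ^ 3 = x ^ 3 + x\<^sup>2 * z + x * z\<^sup>2 + z ^ 3 + 2 * (x\<^sup>2 * z + x * z\<^sup>2)"
    by (simp add: algebra_simps power2_eq_square power3_eq_cube)
  then show ?thesis
    by (simp add: two_eq_0)
qed

lemma add_power5: "(x + z) ^ 5 = x ^ 5 + x ^ 4 * z + x * z ^ 4 + (z::'a) ^ 5"
proof -
  have "(x + z) ^ 5 = x ^ 5 + x ^ 4 * z + x * z ^ 4 + z ^ 5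
      + 2 * (2 * x ^ 4 * z + 5 * x ^ 3 * z ^ 2 + 5 * x ^ 2 * z ^ 3 + 2 * x * z ^ 4)"
    by algebra
  then show ?thesis
    by (simp add: two_eq_0)
qed

text \<open>The linear term \<open>c * x\<close> is additive and leaves no cross term, so
  \<open>rad\<close> depends on \<open>a\<close> and \<open>b\<close> only.\<close>

lemma Tr_cw_add:
  "Tr (cw a b c (x + z)) = Tr (cw a b c x) + Tr (cw a b c z) +
     Tr (x ^ 4 * (a * z + b\<^sup>2 * z\<^sup>2 + b ^ 4 * z ^ 8 + a ^ 4 * z ^ 16))"
proof -
  have "cw a b c (x + z) = cw a b c x + cw a b c z
      + (x ^ 4 * (a * z) + b * x\<^sup>2 * z + b * x * z\<^sup>2 + a * x * z ^ 4)"
    by (simp add: cw_def add_power3 add_power5 algebra_simps)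
  then have "Tr (cw a b c (x + z)) = Tr (cw a b c x) + Tr (cw a b c z)
      + (Tr (x ^ 4 * (a * z)) + Tr (b * x\<^sup>2 * z) + Tr (b * x * z\<^sup>2) + Tr (a * x * z ^ 4))"
    by (simp add: Tr_add)
  also have "Tr (b * x\<^sup>2 * z) = Tr (x ^ 4 * (b\<^sup>2 * z\<^sup>2))"
    using Tr_square[of "b * x\<^sup>2 * z"] by (simp add: power_mult_distrib mult_ac flip: power_mult)
  also have "Tr (b * x * z\<^sup>2) = Tr (x ^ 4 * (b ^ 4 * z ^ 8))"
    using Tr_power4[of "b * x * z\<^sup>2"] by (simp add: power_mult_distrib mult_ac flip: power_mult)
  also have "Tr (a * x * z ^ 4) = Tr (x ^ 4 * (a ^ 4 * z ^ 16))"
    using Tr_power4[of "a * x * z ^ 4"] by (simp add: power_mult_distrib mult_ac flip: power_mult)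
  finally show ?thesis
    by (simp add: Tr_add distrib_left)
qed

lemma chi_cw_add:
  "chi (cw a b c (x + z)) = chi (cw a b c x) * chi (cw a b c z) *
     chi (x ^ 4 * (a * z + b\<^sup>2 * z\<^sup>2 + b ^ 4 * z ^ 8 + a ^ 4 * z ^ 16))"
  unfolding chi_add[symmetric] by (simp add: chi_def Tr_cw_add Tr_add)

text \<open>Put \<open>y = x + z\<close> in the double sum: the \<open>x\<close>-dependence of the
  summand is then \<open>chi (x ^ 4 * P z)\<close>. As \<open>x \<mapsto> x ^ 4\<close> is a
  bijection, orthogonality removes every \<open>z\<close> outside the radical.\<close>

lemma walsh_square: "(walsh a b c)\<^sup>2 = 2 ^ m * (\<Sum>z\<in>rad a b. chi (cw a b c z))"
proof -
  define P where "P z = a * z + b\<^sup>2 * z\<^sup>2 + b ^ 4 * z ^ 8 + a ^ 4 * z ^ 16" for z :: 'a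
  have inner: "(\<Sum>x\<in>UNIV. chi (x ^ 4 * P z)) = (if P z = 0 then 2 ^ m else 0)" for z
    using sum.reindex_bij_betw[OF power_two_power_bij[of 2], of "\<lambda>x. chi (x * P z)"]
    by (simp add: sum_chi_mult)
  have shift: "(\<Sum>z\<in>UNIV. chi (cw a b c (x + z))) = (\<Sum>y\<in>UNIV. chi (cw a b c y))" for x
    by (rule sum.reindex_bij_witness[of _ "\<lambda>y. y - x" "\<lambda>z. x + z"]) auto
  have "(walsh a b c)\<^sup>2 = (\<Sum>x\<in>UNIV. \<Sum>y\<in>UNIV. chi (cw a b c x) * chi (cw a b c y))"
    by (simp add: walsh_def power2_eq_square sum_product)
  also have "\<dots> = (\<Sum>x\<in>UNIV. \<Sum>z\<in>UNIV. chi (cw a b c x) * chi (cw a b c (x + z)))"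
    unfolding sum_distrib_left[symmetric] shift ..
  also have "\<dots> = (\<Sum>x\<in>UNIV. \<Sum>z\<in>UNIV. chi (cw a b c z) * chi (x ^ 4 * P z))"
    unfolding chi_cw_add P_def by (simp add: mult.assoc[symmetric])
  also have "\<dots> = (\<Sum>z\<in>UNIV. chi (cw a b c z) * (\<Sum>x\<in>UNIV. chi (x ^ 4 * P z)))"
    by (subst sum.swap) (simp add: sum_distrib_left)
  also have "\<dots> = (\<Sum>z\<in>UNIV. if z \<in> rad a b then 2 ^ m * chi (cw a b c z) else 0)"
    unfolding inner by (intro sum.cong) (auto simp: rad_def P_def)
  finally show ?thesis
    by (simp add: sum_distrib_left sum.If_cases)
qed

lemma rad_add: "z \<in> rad a b \<Longrightarrow> z' \<in> rad a b \<Longrightarrow> z + z' \<in> rad a b"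
proof -
  assume z: "z \<in> rad a b" "z' \<in> rad a b"
  have "a * (z + z') + b\<^sup>2 * (z + z')\<^sup>2 + b ^ 4 * (z + z') ^ 8 + a ^ 4 * (z + z') ^ 16
    = (a * z + b\<^sup>2 * z\<^sup>2 + b ^ 4 * z ^ 8 + a ^ 4 * z ^ 16)
      + (a * z' + b\<^sup>2 * z'\<^sup>2 + b ^ 4 * z' ^ 8 + a ^ 4 * z' ^ 16)"
    unfolding freshman2 freshman[of z z' 3, simplified] freshman[of z z' 4, simplified]
    by (simp add: algebra_simps)
  with z show ?thesis
    by (simp add: rad_def)
qed

text \<open>On the additive group \<open>rad a b\<close> the last factor in
  \<open>chi_cw_add\<close> is 1, so \<open>chi\<close> of the quadratic form is a character there.
  Its sum is 0 if it takes the value -1, and the size of the group otherwise.\<close>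

lemma walsh_square_cases: "(walsh a b c)\<^sup>2 \<in> {0, 2 ^ m * int (card (rad a b))}"
proof (cases "\<exists>z\<in>rad a b. chi (cw a b c z) = -1")
  case True
  then obtain z where z: "z \<in> rad a b" "chi (cw a b c z) = -1"
    by blast
  have "(\<Sum>x\<in>rad a b. chi (cw a b c x)) = (\<Sum>x\<in>rad a b. chi (cw a b c (x + z)))"
    using z(1) by (intro sum.reindex_bij_witness[of _ "\<lambda>x. x + z" "\<lambda>x. x + z"])
      (auto simp: rad_add add.assoc)
  also have "\<dots> = (\<Sum>x\<in>rad a b. - chi (cw a b c x))"
    using z by (intro sum.cong) (auto simp: chi_cw_add rad_def)
  finally show ?thesis
    by (simp add: walsh_square sum_negf)
next
  case False
  then have "(\<Sum>x\<in>rad a b. chi (cw a b c x)) = (\<Sum>x\<in>rad a b. 1)"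
    using chi_cases by (intro sum.cong) blast+
  then show ?thesis
    by (simp add: walsh_square)
qed

lemma card_rad_le:
  assumes "(a, b) \<noteq> (0, 0)"
  shows "card (rad a b) \<le> 16"
proof -
  define p where "p = monom a 1 + monom (b\<^sup>2) 2 + monom (b ^ 4) 8 + monom (a ^ 4) 16"
  have "coeff p 1 = a" "coeff p 2 = b\<^sup>2"
    by (simp_all add: p_def)
  with assms have "p \<noteq> 0"
    by (metis coeff_0 power_eq_0_iff)
  moreover have "degree p \<le> 16"
    unfolding p_def by (intro degree_add_le order.trans[OF degree_monom_le]) auto
  moreover have "rad a b = {x. poly p x = 0}"
    by (simp add: rad_def p_def poly_monom)
  ultimately show ?thesis
    using card_poly_roots_bound[of p] by simp
qed

text \<open>Summing over \<open>c\<close> kills every \<open>z \<noteq> 0\<close> of the radical.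
  The identity serves to show that the size of the radical divides \<open>2 ^ m\<close>.\<close>

lemma sum_walsh_square: "(\<Sum>c\<in>UNIV. (walsh a b c)\<^sup>2) = (2 ^ m)\<^sup>2"
proof -
  have split: "chi (cw a b c z) = chi (cw a b 0 z) * chi (c * z)" for c z
    by (simp add: cw_def flip: chi_add)
  have "(\<Sum>c\<in>UNIV. \<Sum>z\<in>rad a b. chi (cw a b c z))
      = (\<Sum>z\<in>rad a b. \<Sum>c\<in>UNIV. chi (cw a b 0 z) * chi (c * z))"
    by (subst sum.swap) (intro sum.cong refl split)
  also have "\<dots> = (\<Sum>z\<in>rad a b. if z = 0 then 2 ^ m else 0)"
    by (intro sum.cong refl) (simp add: sum_distrib_left[symmetric] sum_chi_mult cw_def)
  also have "\<dots> = 2 ^ m"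
    by (simp add: rad_def)
  finally show ?thesis
    unfolding walsh_square by (simp add: sum_distrib_left[symmetric] power2_eq_square)
qed

lemma walsh_square_values:
  assumes "even m" and "(a, b) \<noteq> (0, 0)"
  shows "(walsh a b c)\<^sup>2 \<in> {0, 2 ^ m, 4 * 2 ^ m, 16 * 2 ^ m}"
proof -
  define D where "D = card (rad a b)"
  define N where "N = card {c. (walsh a b c)\<^sup>2 = 2 ^ m * int D}"
  \<comment> \<open>All nonzero squares equal \<open>2 ^ m * D\<close>, so their sum over
    \<open>c\<close> is this value times \<open>N\<close>; hence \<open>D * N = 2 ^ m\<close> and
    \<open>D\<close> is a power of 2.\<close>
  have "(2 ^ m)\<^sup>2 = (\<Sum>c\<in>UNIV. if (walsh a b c)\<^sup>2 = 2 ^ m * int D then 2 ^ m * int D else 0)"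
    unfolding sum_walsh_square[symmetric, of a b] D_def
    by (intro sum.cong refl) (use walsh_square_cases in auto)
  also have "\<dots> = 2 ^ m * (int D * int N)"
    by (simp add: sum.If_cases N_def)
  finally have "int (2 ^ m) = int (D * N)"
    by (simp add: power2_eq_square)
  then have DN: "2 ^ m = D * N"
    by (simp only: of_nat_eq_iff)
  then obtain j where j: "j \<le> m" "D = 2 ^ j"
    using divides_primepow_nat[of 2 D m] by auto
  from DN have "N \<noteq> 0"
    by (metis mult_zero_right power_not_zero zero_neq_numeral)
  then obtain c' where "(walsh a b c')\<^sup>2 = 2 ^ m * int D"
    unfolding N_def by (metis (mono_tags, lifting) card.empty empty_Collect_eq)
  then have sq: "(walsh a b c')\<^sup>2 = 2 ^ (m + j)"
    by (simp add: j power_add)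
  \<comment> \<open>The exponent of 2 in a perfect square is even; with \<open>m\<close> even this
    forces \<open>j\<close> to be even.\<close>
  then have "multiplicity 2 ((walsh a b c')\<^sup>2) = m + j"
    by (simp add: multiplicity_same_power)
  moreover have "walsh a b c' \<noteq> 0"
    using sq by auto
  ultimately have "m + j = 2 * multiplicity 2 (walsh a b c')"
    by (simp add: prime_elem_multiplicity_power_distrib)
  with assms(1) have "even j"
    by presburger
  moreover have "j < 5"
  proof (rule ccontr)
    assume "\<not> j < 5"
    then have "(2::nat) ^ 5 \<le> D"
      unfolding j by (intro power_increasing) auto
    with card_rad_le[OF assms(2)] show False
      by (simp add: D_def)
  qed
  ultimately have "j = 0 \<or> j = 2 \<or> j = 4"
    by presburger
  then have "D = 1 \<or> D = 4 \<or> D = 16"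
    by (auto simp: j)
  then show ?thesis
    using walsh_square_cases[of a b c] by (auto simp flip: D_def)
qed

lemma walsh_0_0: "walsh 0 0 c = (if c = 0 then 2 ^ m else 0)"
  using sum_chi_mult[of c] by (simp add: walsh_def cw_def mult.commute)

subsection \<open>Moments of the Walsh transform\<close>

text \<open>In characteristic \<open>2\<close> the hypotheses for \<open>j = 1, 3, 5\<close> give the cases \<open>j = 2, 4\<close>, and \<open>j = 0\<close> is the parity
  of the length. So every polynomial \<open>p\<close> of degree at most \<open>5\<close> satisfies \<open>p x = (\<Sum>y\<leftarrow>ys. p y)\<close>; take the one
  with roots \<open>ys\<close>.\<close>

lemma power_sums_repeat:
  fixes x :: 'a
  assumes "odd (length ys)" and "length ys < 6"
    and "\<And>j. j \<in> {1, 3, 5} \<Longrightarrow> x ^ j = (\<Sum>y\<leftarrow>ys. y ^ j)"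
  shows "x \<in> set ys"
proof -
  define p where "p = (\<Prod>y\<leftarrow>ys. [:- y, 1:])"
  have sum_list_square: "(\<Sum>y\<leftarrow>zs. y ^ j)\<^sup>2 = (\<Sum>y\<leftarrow>zs. y ^ (2 * j))" for zs :: "'a list" and j
    by (induction zs) (simp_all add: freshman2 mult.commute flip: power_mult)
  have "x ^ 2 = (\<Sum>y\<leftarrow>ys. y ^ 2)"
    using assms(3)[of 1] sum_list_square[of 1 ys] by simp
  moreover have "x ^ 4 = (\<Sum>y\<leftarrow>ys. y ^ 4)"
    using calculation sum_list_square[of 2 ys] power_mult[of x 2 2] by simp
  moreover have "x ^ 0 = (\<Sum>y\<leftarrow>ys. y ^ 0)"
    using assms(1) by (auto simp: sum_list_triv two_eq_0 elim!: oddE)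
  ultimately have sums: "x ^ j = (\<Sum>y\<leftarrow>ys. y ^ j)" if "j \<in> {0, 1, 2, 3, 4, 5}" for j
    using that assms(3)[of j] by auto
  have "poly p z = 0 \<longleftrightarrow> z \<in> set ys" for z
    unfolding p_def by (induction ys) auto
  moreover have "degree p = length ys"
  proof -
    have "(\<Prod>y\<leftarrow>zs. [:- y, 1:]) \<noteq> 0 \<and> degree (\<Prod>y\<leftarrow>zs. [:- y, 1:]) = length zs" for zs :: "'a list"
    proof (induction zs)
      case (Cons z zs)
      then show ?case
        using degree_mult_eq[of "[:- z, 1:]" "\<Prod>y\<leftarrow>zs. [:- y, 1:]"]
        by (simp del: mult_pCons_left)
    qed simp
    then show ?thesis
      by (simp add: p_def)
  qed
  moreover have "poly p x = (\<Sum>y\<leftarrow>ys. poly p y)"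
  proof -
    have "poly p x = (\<Sum>j\<le>degree p. coeff p j * x ^ j)"
      by (rule poly_altdef)
    also have "\<dots> = (\<Sum>j\<le>degree p. \<Sum>y\<leftarrow>ys. coeff p j * y ^ j)"
    proof (rule sum.cong[OF refl])
      fix j
      assume "j \<in> {..degree p}"
      then have "j < 6"
        using assms(2) \<open>degree p = length ys\<close> by simp
      then have "j \<in> {0, 1, 2, 3, 4, 5}"
        by auto
      then show "coeff p j * x ^ j = (\<Sum>y\<leftarrow>ys. coeff p j * y ^ j)"
        by (simp only: sums sum_list_const_mult)
    qed
    also have "\<dots> = (\<Sum>y\<leftarrow>ys. \<Sum>j\<le>degree p. coeff p j * y ^ j)"
      by (induction ys) (simp_all add: sum.distrib)
    finally show ?thesis
      by (simp add: poly_altdef)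
  qed
  moreover have "(\<Sum>y\<leftarrow>ys. poly p y) = (\<Sum>y\<leftarrow>ys. 0)"
    using calculation(1) by (intro arg_cong[of _ _ sum_list] map_cong) auto
  ultimately show ?thesis
    by simp
qed

section \<open>Coincidences of power sums of pairs and triples\<close>

definition same2 :: "'a \<times> 'a \<Rightarrow> 'a \<times> 'a \<Rightarrow> bool" where
  "same2 X Y \<longleftrightarrow> (case X of (x1, x2) \<Rightarrow> case Y of (y1, y2) \<Rightarrow>
     \<forall>j\<in>{1, 3, 5}. x1 ^ j + x2 ^ j = y1 ^ j + y2 ^ j)"

definition same3 :: "'a \<times> 'a \<times> 'a \<Rightarrow> 'a \<times> 'a \<times> 'a \<Rightarrow> bool" where
  "same3 X Y \<longleftrightarrow> (case X of (x1, x2, x3) \<Rightarrow> case Y of (y1, y2, y3) \<Rightarrow>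
     \<forall>j\<in>{1, 3, 5}. x1 ^ j + x2 ^ j + x3 ^ j = y1 ^ j + y2 ^ j + y3 ^ j)"

lemma add_eq_iff_eq_add: "x + y = z \<longleftrightarrow> x = y + (z::'a)"
proof
  assume "x + y = z"
  then show "x = y + z"
    using add.left_commute[of y x y] by simp
next
  assume "x = y + z"
  then show "x + y = z"
    using add.left_commute[of y z y] by (simp add: add.assoc)
qed

lemma same2_mem:
  assumes "same2 (x1, x2) (y1, y2)"
  shows "x1 \<in> {x2, y1, y2}"
proof -
  \<comment> \<open>In characteristic 2 all other terms move to the right without sign, leaving an
    odd number of them as \<open>power_sums_repeat\<close> requires.\<close>
  have "x1 ^ j = (\<Sum>y\<leftarrow>[x2, y1, y2]. y ^ j)" if "j \<in> {1, 3, 5}" for j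
  proof -
    have "x1 ^ j + x2 ^ j = y1 ^ j + y2 ^ j"
      using assms that by (auto simp: same2_def)
    from iffD1[OF add_eq_iff_eq_add this] show ?thesis
      by (simp add: add.assoc)
  qed
  then have "x1 \<in> set [x2, y1, y2]"
    by (intro power_sums_repeat) auto
  then show ?thesis
    by simp
qed

lemma same3_mem:
  assumes "same3 (x1, x2, x3) (y1, y2, y3)"
  shows "x1 \<in> {x2, x3, y1, y2, y3}"
proof -
  have "x1 ^ j = (\<Sum>y\<leftarrow>[x2, x3, y1, y2, y3]. y ^ j)" if "j \<in> {1, 3, 5}" for j
  proof -
    have "x1 ^ j + (x2 ^ j + x3 ^ j) = y1 ^ j + y2 ^ j + y3 ^ j"
      using assms that by (auto simp: same3_def add.assoc)
    from iffD1[OF add_eq_iff_eq_add this] show ?thesis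
      by (simp add: add.assoc)
  qed
  then have "x1 \<in> set [x2, x3, y1, y2, y3]"
    by (intro power_sums_repeat) auto
  then show ?thesis
    by simp
qed

text \<open>Equal entries cancel and force \<open>y1 = y2\<close>. For distinct entries,
  \<open>same2_mem\<close> applied to each of them leaves only the two orders of the same
  pair.\<close>

lemma card_same2: "card {Y. same2 (x1, x2) Y} = (if x1 = x2 then 2 ^ m else 2)"
proof (cases "x1 = x2")
  case True
  have "same2 (x1, x2) (y1, y2) \<longleftrightarrow> y1 = y2" for y1 y2
    using add_eq_0_iff_eq[of y1 y2] True by (auto simp: same2_def)
  then have "{Y. same2 (x1, x2) Y} = (\<lambda>y. (y, y)) ` UNIV"
    by auto
  then have "card {Y. same2 (x1, x2) Y} = CARD('a)"
    by (simp add: card_image inj_def)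
  with True show ?thesis
    by (simp add: card_field)
next
  case False
  have "{Y. same2 (x1, x2) Y} = {(x1, x2), (x2, x1)}"
  proof (intro equalityI subsetI)
    fix Y
    assume Y: "Y \<in> {Y. same2 (x1, x2) Y}"
    obtain y1 y2 where [simp]: "Y = (y1, y2)"
      by fastforce
    have "same2 (x1, x2) (y1, y2)" "same2 (x2, x1) (y1, y2)"
      using Y by (auto simp: same2_def add.commute)
    from this[THEN same2_mem] show "Y \<in> {(x1, x2), (x2, x1)}"
      using False by auto
  qed (auto simp: same2_def add.commute)
  with False show ?thesis
    by simp
qed

text \<open>One entry is \<open>z\<close> and the other two cancel. The three families meet only in
  \<open>(z, z, z)\<close>, so the count is three times \<open>2 ^ m - 1\<close>, plus 1.\<close>

lemma card_cancelling_triples: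
  "int (card {(y1::'a, y2, y3). y1 = z \<and> y2 = y3 \<or> y2 = z \<and> y1 = y3 \<or> y3 = z \<and> y1 = y2}) = 3 * 2 ^ m - 2"
proof -
  let ?R = "UNIV - {z}"
  define A where "A = (\<lambda>w. (z, w, w)) ` ?R"
  define B where "B = (\<lambda>w. (w, z, w)) ` ?R"
  define D where "D = (\<lambda>w. (w, w, z)) ` ?R"
  have cards: "card A = card ?R" "card B = card ?R" "card D = card ?R"
    unfolding A_def B_def D_def by (rule card_image; auto simp: inj_on_def)+
  have disj: "(z, z, z) \<notin> A \<union> B \<union> D" "(A \<union> B) \<inter> D = {}" "A \<inter> B = {}"
    unfolding A_def B_def D_def by auto
  have "{(y1::'a, y2, y3). y1 = z \<and> y2 = y3 \<or> y2 = z \<and> y1 = y3 \<or> y3 = z \<and> y1 = y2}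
    = insert (z, z, z) (A \<union> B \<union> D)"
    unfolding A_def B_def D_def by auto
  also have "card \<dots> = Suc (card A + card B + card D)"
    using disj by (simp add: card_Un_disjoint)
  also have "\<dots> = Suc (3 * card ?R)"
    using cards by linarith
  also have "int \<dots> = 3 * 2 ^ m - 2"
    by (simp add: card_Diff_singleton card_field of_nat_diff)
  finally show ?thesis .
qed

lemma card_same3:
  "int (card {Y. same3 (x1, x2, x3) Y}) = (if distinct [x1, x2, x3] then 6 else 3 * 2 ^ m - 2)"
proof (cases "distinct [x1, x2, x3]")
  case True
  let ?S = "{(x1, x2, x3), (x1, x3, x2), (x2, x1, x3), (x2, x3, x1), (x3, x1, x2), (x3, x2, x1)}"
  have "{Y. same3 (x1, x2, x3) Y} = ?S"
  proof (intro equalityI subsetI)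
    fix Y
    assume Y: "Y \<in> {Y. same3 (x1, x2, x3) Y}"
    obtain y1 y2 y3 where [simp]: "Y = (y1, y2, y3)"
      by (cases Y)
    have "same3 (x1, x2, x3) (y1, y2, y3)" "same3 (x2, x1, x3) (y1, y2, y3)"
      "same3 (x3, x1, x2) (y1, y2, y3)"
      using Y by (auto simp: same3_def add_ac)
    from this[THEN same3_mem] show "Y \<in> ?S"
      using True by auto
  qed (auto simp: same3_def add_ac)
  with True show ?thesis
    by auto
next
  case False
  then obtain z where z: "\<And>j. x1 ^ j + x2 ^ j + x3 ^ j = z ^ j"
  proof -
    \<comment> \<open>Two equal entries cancel; the witness is the entry that remains.\<close>
    have "x1 ^ j + x2 ^ j + x3 ^ j = (if x1 = x2 then x3 else if x1 = x3 then x2 else x1) ^ j" for j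
      using False by (auto simp: add_ac)
    then show ?thesis
      by (rule that)
  qed
  have "{Y. same3 (x1, x2, x3) Y}
    = {(y1, y2, y3). y1 = z \<and> y2 = y3 \<or> y2 = z \<and> y1 = y3 \<or> y3 = z \<and> y1 = y2}"
  proof (intro equalityI subsetI)
    fix Y
    assume Y: "Y \<in> {Y. same3 (x1, x2, x3) Y}"
    obtain y1 y2 y3 where [simp]: "Y = (y1, y2, y3)"
      by (cases Y)
    have sums: "z ^ j = y1 ^ j + y2 ^ j + y3 ^ j" if "j \<in> {1, 3, 5}" for j
      using Y z[of j] that by (auto simp: same3_def)
    \<comment> \<open>Once \<open>z\<close> is one of the three entries, the first power sum makes
      the other two equal.\<close>
    then have "z \<in> set [y1, y2, y3]"
      by (intro power_sums_repeat) (auto simp: add_ac)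
    moreover have "z = y1 + y2 + y3"
      using sums[of 1] by simp
    ultimately show "Y \<in> {(y1, y2, y3). y1 = z \<and> y2 = y3 \<or> y2 = z \<and> y1 = y3 \<or> y3 = z \<and> y1 = y2}"
      by (auto simp: add.assoc add_eq_0_iff_eq add.left_commute[of y1 y2])
  next
    fix Y
    assume "Y \<in> {(y1, y2, y3). y1 = z \<and> y2 = y3 \<or> y2 = z \<and> y1 = y3 \<or> y3 = z \<and> y1 = y2}"
    then have "case Y of (y1, y2, y3) \<Rightarrow> y1 ^ j + y2 ^ j + y3 ^ j = z ^ j" for j
      by (auto simp: add.assoc add.left_commute[of _ "z ^ j"])
    from this[of 1] this[of 3] this[of 5] show "Y \<in> {Y. same3 (x1, x2, x3) Y}"
      using z[of 1] z[of 3] z[of 5] by (auto simp: same3_def)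
  qed
  with False show ?thesis
    by (simp only: card_cancelling_triples if_False)
qed

lemma card_pairs: "int (card {(X::'b::finite, Y::'b). P X Y}) = (\<Sum>X\<in>UNIV. int (card {Y. P X Y}))"
proof -
  have "{(X, Y). P X Y} = (SIGMA X:UNIV. {Y. P X Y})"
    by auto
  then show ?thesis
    by simp
qed

lemma sum_UNIV_prod: "(\<Sum>X\<in>UNIV. f X) = (\<Sum>x\<in>UNIV. \<Sum>y\<in>UNIV. f (x, y))"
  for f :: "'b::finite \<times> 'c::finite \<Rightarrow> int"
  by (simp add: sum.cartesian_product)

lemma sum_two_values:
  fixes u v :: int
  shows "(\<Sum>x\<in>(UNIV::'a set). if x \<in> A then u else v) = int (card A) * u + (2 ^ m - int (card A)) * v"
proof -
  have "card (- A) = 2 ^ m - card A" "card A \<le> 2 ^ m"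
    using card_field card_mono[of UNIV A] by (simp_all add: Compl_eq_Diff_UNIV card_Diff_subset)
  then show ?thesis
    by (simp add: sum.If_cases of_nat_diff)
qed

lemma card_same2_pairs: "int (card {(X, Y). same2 X Y}) = 2 ^ m * (3 * 2 ^ m - 2)"
proof -
  have "(\<Sum>x2\<in>UNIV. int (card {Y. same2 (x1, x2) Y})) = 3 * 2 ^ m - 2" for x1
    using sum_two_values[of "{x1}" "2 ^ m" 2] by (simp add: card_same2 eq_commute if_distrib cong: if_cong)
  then show ?thesis
    by (simp add: card_pairs sum_UNIV_prod card_field)
qed

lemma card_same3_pairs:
  "int (card {(X, Y). same3 X Y}) = 2 ^ m * (15 * (2 ^ m)\<^sup>2 - 30 * 2 ^ m + 16)"
proof -
  define Q :: int where "Q = 2 ^ m"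
  \<comment> \<open>If \<open>x2 = x1\<close>, every \<open>x3\<close> gives a repeated entry.
    Otherwise exactly two choices of \<open>x3\<close> do, and the other \<open>Q - 2\<close>
    contribute 6 each.\<close>
  have 1: "(\<Sum>x3\<in>UNIV. int (card {Y. same3 (x1, x2, x3) Y}))
      = (if x2 \<in> {x1} then Q * (3 * Q - 2) else 12 * Q - 16)" for x1 x2
  proof (cases "x2 = x1")
    case True
    then show ?thesis
      by (simp add: card_same3 card_field Q_def)
  next
    case False
    then have "int (card {Y. same3 (x1, x2, x3) Y}) = (if x3 \<in> {x1, x2} then 3 * Q - 2 else 6)" for x3
      by (auto simp: card_same3 Q_def)
    then have "(\<Sum>x3\<in>UNIV. int (card {Y. same3 (x1, x2, x3) Y})) = 2 * (3 * Q - 2) + (Q - 2) * 6"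
      using False by (simp only: sum_two_values) (simp add: Q_def)
    with False show ?thesis
      by simp
  qed
  have "(\<Sum>x2\<in>UNIV. \<Sum>x3\<in>UNIV. int (card {Y. same3 (x1, x2, x3) Y}))
      = Q * (3 * Q - 2) + (Q - 1) * (12 * Q - 16)" for x1
    unfolding 1 sum_two_values by (simp add: Q_def)
  then show ?thesis
    by (simp add: card_pairs sum_UNIV_prod card_field Q_def[symmetric])
      (simp add: Q_def algebra_simps power2_eq_square)
qed

text \<open>Expand the square into pairs \<open>(X, Y)\<close> and apply orthogonality to
  \<open>a\<close>, \<open>b\<close> and \<open>c\<close> separately. The index type is left general
  so that elements, pairs and triples yield the moments of orders 2, 4 and 6.\<close>

lemma sum_square_chi:
  fixes f g h :: "'b::finite \<Rightarrow> 'a"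
  shows "(\<Sum>(a, b, c)\<in>UNIV. (\<Sum>X\<in>UNIV. chi (a * f X + b * g X + c * h X))\<^sup>2)
    = (2 ^ m) ^ 3 * int (card {(X, Y). f X = f Y \<and> g X = g Y \<and> h X = h Y})"
proof -
  let ?F = "\<lambda>a b c X Y. chi (a * (f X + f Y)) * (chi (b * (g X + g Y)) * chi (c * (h X + h Y)))"
  have "(\<Sum>(a, b, c)\<in>UNIV. (\<Sum>X\<in>UNIV. chi (a * f X + b * g X + c * h X))\<^sup>2)
      = (\<Sum>A\<in>UNIV. \<Sum>(X, Y)\<in>UNIV. case A of (a, b, c) \<Rightarrow> ?F a b c X Y)"
    by (intro sum.cong refl)
      (auto simp: power2_eq_square sum_product chi_add distrib_left sum_UNIV_prod mult_ac)
  also have "\<dots> = (\<Sum>(X, Y)\<in>UNIV. \<Sum>(a, b, c)\<in>UNIV. ?F a b c X Y)"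
    by (subst sum.swap) (simp add: case_prod_unfold)
  also have "\<dots> = (\<Sum>(X, Y)\<in>UNIV. if f X = f Y \<and> g X = g Y \<and> h X = h Y then (2 ^ m) ^ 3 else 0)"
    by (intro sum.cong refl)
      (simp add: sum_UNIV_prod sum_distrib_left[symmetric] sum_distrib_right[symmetric] sum_chi_mult
        add_eq_0_iff_eq power3_eq_cube split: prod.splits)
  also have "\<dots> = (2 ^ m) ^ 3 * int (card {(X, Y). f X = f Y \<and> g X = g Y \<and> h X = h Y})"
    by (simp add: case_prod_unfold sum.If_cases)
  finally show ?thesis .
qed

lemma walsh_moment2: "(\<Sum>(a, b, c)\<in>UNIV. (walsh a b c)\<^sup>2) = (2 ^ m) ^ 4"
proof -
  have "{(x::'a, y). x ^ 5 = y ^ 5 \<and> x ^ 3 = y ^ 3 \<and> x = y} = (\<lambda>x. (x, x)) ` UNIV"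
    by auto
  then have "card {(x::'a, y). x ^ 5 = y ^ 5 \<and> x ^ 3 = y ^ 3 \<and> x = y} = 2 ^ m"
    by (simp add: card_image inj_def card_field)
  then show ?thesis
    using sum_square_chi[of "\<lambda>x. x ^ 5" "\<lambda>x. x ^ 3" "\<lambda>x. x"]
    by (simp add: walsh_def cw_def flip: power_Suc2)
qed

lemma walsh_moment4: "(\<Sum>(a, b, c)\<in>UNIV. (walsh a b c) ^ 4) = (2 ^ m) ^ 4 * (3 * 2 ^ m - 2)"
proof -
  \<comment> \<open>The square of the sum is a character sum over pairs, so the fourth moment is
    again a sum of squares of the form in \<open>sum_square_chi\<close>.\<close>
  have square: "(walsh a b c)\<^sup>2 = (\<Sum>X\<in>UNIV. chi (a * (fst X ^ 5 + snd X ^ 5)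
      + b * (fst X ^ 3 + snd X ^ 3) + c * (fst X + snd X)))" for a b c
    unfolding walsh_def power2_eq_square sum_product sum_UNIV_prod
    by (simp add: cw_def algebra_simps flip: chi_add)
  have "(\<Sum>(a, b, c)\<in>UNIV. (walsh a b c) ^ 4)
      = (\<Sum>(a, b, c)\<in>UNIV. (\<Sum>X\<in>UNIV. chi (a * (fst X ^ 5 + snd X ^ 5)
        + b * (fst X ^ 3 + snd X ^ 3) + c * (fst X + snd X)))\<^sup>2)"
    using power_mult[of "walsh _ _ _" 2 2] by (simp flip: square)
  also have "\<dots> = (2 ^ m) ^ 3 * int (card {(X, Y). same2 X Y})"
    unfolding sum_square_chi
    by (rule arg_cong[of _ _ "\<lambda>S. (2 ^ m) ^ 3 * int (card S)"]) (auto simp: same2_def)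
  finally show ?thesis
    by (simp add: card_same2_pairs power_numeral_reduce)
qed

lemma walsh_moment6:
  "(\<Sum>(a, b, c)\<in>UNIV. (walsh a b c) ^ 6) = (2 ^ m) ^ 4 * (15 * (2 ^ m)\<^sup>2 - 30 * 2 ^ m + 16)"
proof -
  let ?p = "\<lambda>j X. fst X ^ j + fst (snd X) ^ j + snd (snd X) ^ j :: 'a"
  have "walsh a b c * walsh a b c * walsh a b c
      = (\<Sum>X\<in>UNIV. chi (a * ?p 5 X + b * ?p 3 X + c * ?p 1 X))" for a b c
    unfolding walsh_def sum_product sum_UNIV_prod sum_distrib_right sum_distrib_left
    by (simp add: cw_def algebra_simps flip: chi_add)
  then have cube: "(walsh a b c) ^ 3 = (\<Sum>X\<in>UNIV. chi (a * ?p 5 X + b * ?p 3 X + c * ?p 1 X))" for a b c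
    by (simp only: power3_eq_cube)
  have "(\<Sum>(a, b, c)\<in>UNIV. (walsh a b c) ^ 6)
      = (\<Sum>(a, b, c)\<in>UNIV. (\<Sum>X\<in>UNIV. chi (a * ?p 5 X + b * ?p 3 X + c * ?p 1 X))\<^sup>2)"
    using power_mult[of "walsh _ _ _" 3 2] unfolding cube[symmetric] by simp
  also have "\<dots> = (2 ^ m) ^ 3 * int (card {(X, Y). same3 X Y})"
    unfolding sum_square_chi
    by (rule arg_cong[of _ _ "\<lambda>S. (2 ^ m) ^ 3 * int (card S)"]) (auto simp: same3_def)
  finally show ?thesis
    by (simp add: card_same3_pairs power_numeral_reduce)
qed

section \<open>Value distribution of the squared Walsh transform\<close>

definition count_walsh_square :: "int \<Rightarrow> int" where
  "count_walsh_square v = int (card {(a, b, c). (walsh a b c)\<^sup>2 = v})"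

text \<open>For \<open>m \<ge> 6\<close> the value at the zero triple exceeds
  \<open>16 * 2 ^ m\<close>, the largest value possible when
  \<open>(a, b) \<noteq> (0, 0)\<close>.\<close>

lemma walsh_square_eq_max:
  assumes "even m" and "m \<ge> 6"
  shows "(walsh a b c)\<^sup>2 = (2 ^ m)\<^sup>2 \<longleftrightarrow> a = 0 \<and> b = 0 \<and> c = 0"
proof -
  have "(2::int) ^ 6 \<le> 2 ^ m"
    using assms(2) by (intro power_increasing) auto
  then have "16 * 2 ^ m < (2 ^ m :: int)\<^sup>2"
    by (simp add: power2_eq_square)
  then show ?thesis
    using walsh_square_values[OF assms(1), of a b c] by (cases "(a, b) = (0, 0)") (auto simp: walsh_0_0)
qed

lemma walsh_square_range:
  assumes "even m"
  shows "(walsh a b c)\<^sup>2 \<in> {0, 2 ^ m, 4 * 2 ^ m, 16 * 2 ^ m, (2 ^ m)\<^sup>2}"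
  using walsh_square_values[OF assms, of a b c] by (cases "(a, b) = (0, 0)") (auto simp: walsh_0_0)

text \<open>The value \<open>Q\<^sup>2\<close> occurs once, so four moments determine the four
  remaining counts. Denominators are cleared to stay within the integers.\<close>

lemma walsh_square_distribution:
  assumes "even m" and "m \<ge> 6"
  defines "Q \<equiv> 2 ^ m"
  shows "64 * count_walsh_square 0 = (Q - 1) * (29 * Q\<^sup>2 - 4 * Q + 64)"
    and "15 * count_walsh_square Q = 2 * Q * (Q - 1) * (3 * Q + 8)"
    and "48 * count_walsh_square (4 * Q) = 7 * Q\<^sup>2 * (Q - 1)"
    and "960 * count_walsh_square (16 * Q) = Q * (Q - 1) * (Q - 4)"
proof -
  have "(2::int) ^ 6 \<le> Q"
    unfolding Q_def using assms(2) by (intro power_increasing) auto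
  then have Q: "Q \<ge> 64"
    by simp
  then have Q2: "16 * Q < Q\<^sup>2"
    by (simp add: power2_eq_square)
  let ?V = "{0, Q, 4 * Q, 16 * Q, Q\<^sup>2}"
  let ?n = count_walsh_square
  \<comment> \<open>The convention \<open>0 ^ 0 = 1\<close> makes \<open>k = 0\<close> count all
    triples, including those with value 0.\<close>
  have moment: "(\<Sum>(a, b, c)\<in>UNIV. ((walsh a b c)\<^sup>2) ^ k)
      = ?n 0 * 0 ^ k + ?n Q * Q ^ k + ?n (4 * Q) * (4 * Q) ^ k + ?n (16 * Q) * (16 * Q) ^ k
        + ?n (Q\<^sup>2) * (Q\<^sup>2) ^ k" for k
  proof -
    have "(\<Sum>(a, b, c)\<in>UNIV. ((walsh a b c)\<^sup>2) ^ k)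
        = (\<Sum>A\<in>UNIV. \<Sum>v\<in>?V. if (case A of (a, b, c) \<Rightarrow> (walsh a b c)\<^sup>2) = v then v ^ k else 0)"
    proof (intro sum.cong refl)
      fix A :: "'a \<times> 'a \<times> 'a"
      obtain a b c where A: "A = (a, b, c)"
        by (cases A)
      have "(walsh a b c)\<^sup>2 \<in> ?V"
        unfolding Q_def by (rule walsh_square_range[OF assms(1)])
      then show "(case A of (a, b, c) \<Rightarrow> ((walsh a b c)\<^sup>2) ^ k)
          = (\<Sum>v\<in>?V. if (case A of (a, b, c) \<Rightarrow> (walsh a b c)\<^sup>2) = v then v ^ k else 0)"
        by (subst sum.delta') (simp_all add: A)
    qed
    also have "\<dots> = (\<Sum>v\<in>?V. ?n v * v ^ k)"
      by (subst sum.swap) (simp add: count_walsh_square_def sum.If_cases case_prod_unfold)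
    finally show ?thesis
      \<comment> \<open>The bounds on \<open>Q\<close> make the five elements of \<open>?V\<close>
        distinct, so the sum splits into five terms.\<close>
      using Q Q2 by simp
  qed
  have "{(a, b, c). (walsh a b c)\<^sup>2 = Q\<^sup>2} = {(0, 0, 0)}"
    unfolding Q_def using walsh_square_eq_max[OF assms(1,2)] by auto
  then have max: "?n (Q\<^sup>2) = 1"
    by (simp add: count_walsh_square_def)
  note moment = moment[unfolded max]
  have m0: "?n 0 + ?n Q + ?n (4 * Q) + ?n (16 * Q) = Q ^ 3 - 1"
    using moment[of 0] by (simp add: card_field Q_def[symmetric] power3_eq_cube)
  have "Q * (?n Q + 4 * ?n (4 * Q) + 16 * ?n (16 * Q) + Q) = Q * Q ^ 3"
    using moment[of 1] walsh_moment2 by (simp add: Q_def[symmetric] algebra_simps power_numeral_reduce)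
  then have m2: "?n Q + 4 * ?n (4 * Q) + 16 * ?n (16 * Q) = Q ^ 3 - Q"
    using Q by simp
  have "Q\<^sup>2 * (?n Q + 16 * ?n (4 * Q) + 256 * ?n (16 * Q) + Q\<^sup>2) = Q\<^sup>2 * (Q\<^sup>2 * (3 * Q - 2))"
    using moment[of 2] walsh_moment4 by (simp add: Q_def[symmetric] algebra_simps power_numeral_reduce flip: power_mult)
  then have "?n Q + 16 * ?n (4 * Q) + 256 * ?n (16 * Q) + Q\<^sup>2 = Q\<^sup>2 * (3 * Q - 2)"
    using Q by (simp only: mult_cancel_left) simp
  then have m4: "?n Q + 16 * ?n (4 * Q) + 256 * ?n (16 * Q) = Q\<^sup>2 * (3 * Q - 2) - Q\<^sup>2"
    by simp
  have "Q ^ 3 * (?n Q + 64 * ?n (4 * Q) + 4096 * ?n (16 * Q) + Q ^ 3) = Q ^ 3 * (Q * (15 * Q\<^sup>2 - 30 * Q + 16))"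
    using moment[of 3] walsh_moment6 by (simp add: Q_def[symmetric] algebra_simps power_numeral_reduce flip: power_mult)
  then have m6: "?n Q + 64 * ?n (4 * Q) + 4096 * ?n (16 * Q) = Q * (15 * Q\<^sup>2 - 30 * Q + 16) - Q ^ 3"
    using Q by simp
  show "64 * ?n 0 = (Q - 1) * (29 * Q\<^sup>2 - 4 * Q + 64)"
    "15 * ?n Q = 2 * Q * (Q - 1) * (3 * Q + 8)"
    "48 * ?n (4 * Q) = 7 * Q\<^sup>2 * (Q - 1)"
    "960 * ?n (16 * Q) = Q * (Q - 1) * (Q - 4)"
    using m0 m2 m4 m6 by (simp_all add: algebra_simps power2_eq_square power3_eq_cube)
qed

subsection \<open>Weights of the codewords\<close>

definition word :: "'a \<times> 'a \<times> 'a \<Rightarrow> 'a \<Rightarrow> 'a \<Rightarrow> 'a" where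
  "word A h x = (case A of (a, b, c) \<Rightarrow> Tr (cw a b c x) + h)"

lemma trace_code_eq: "trace_code m = {word A h | A h. h \<in> {0, 1}}"
proof -
  have "(\<lambda>x. Tr (a * x ^ 5 + b * x ^ 3 + c * x) + h) = word (a, b, c) h" for a b c h
    by (auto simp: word_def cw_def)
  then show ?thesis
    unfolding trace_code_def by auto
qed

lemma trace_code_values: "w \<in> trace_code m \<Longrightarrow> w x \<in> {0, 1}" for w :: "'a \<Rightarrow> 'a"
proof -
  assume "w \<in> trace_code m"
  then obtain a b c h where "h \<in> {0, 1}" and "w x = Tr (a * x ^ 5 + b * x ^ 3 + c * x) + h"
    by (auto simp: trace_code_def)
  then show ?thesis
    using Tr_01[of "a * x ^ 5 + b * x ^ 3 + c * x"] by auto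
qed

text \<open>The character sum is the number of zeros minus the number of ones of the trace part, and
  adding \<open>h = 1\<close> complements the support.\<close>

lemma weight_word:
  assumes "h \<in> {0, 1}"
  shows "2 * int (hamming_weight (word (a, b, c) h))
    = 2 ^ m - (if h = 0 then walsh a b c else - walsh a b c)"
proof -
  let ?Z = "{x. Tr (cw a b c x) \<noteq> 0}"
  have "walsh a b c = (\<Sum>x\<in>UNIV. if x \<in> ?Z then - 1 else 1)"
    unfolding walsh_def chi_def by (intro sum.cong) auto
  then have "walsh a b c = 2 ^ m - 2 * int (card ?Z)"
    unfolding sum_two_values by simp
  moreover have "{x. word (a, b, c) h x \<noteq> 0} = (if h = 0 then ?Z else - ?Z)"
    using assms Tr_01 by (force simp: word_def)
  moreover have "card (- ?Z) = 2 ^ m - card ?Z" "card ?Z \<le> 2 ^ m"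
    using card_field card_mono[of UNIV ?Z] by (simp_all add: Compl_eq_Diff_UNIV card_Diff_subset)
  ultimately show ?thesis
    by (simp add: hamming_weight_def of_nat_diff)
qed

text \<open>If two words agree, the difference of their trace parts is constant, so its
  \<open>walsh\<close> value is \<open>2 ^ m\<close> up to sign; this occurs only for the zero
  triple. Counting codewords thus reduces to counting parameters.\<close>

lemma word_inj:
  assumes "even m" and "m \<ge> 6" and "word A h = word A' h'"
  shows "A = A' \<and> h = h'"
proof -
  obtain a b c where A: "A = (a, b, c)" by (cases A)
  obtain a' b' c' where A': "A' = (a', b', c')" by (cases A')
  have "Tr (cw (a + a') (b + b') (c + c') x) = h + h'" for x
  proof -
    have "Tr (cw a b c x) + h = Tr (cw a' b' c' x) + h'"
      using fun_cong[OF assms(3), of x] by (simp add: word_def A A')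
    then have "Tr (cw a b c x) + Tr (cw a' b' c' x) = h + h'"
      by (simp add: add_eq_iff_eq_add add_ac)
    moreover have "cw (a + a') (b + b') (c + c') x = cw a b c x + cw a' b' c' x"
      by (simp add: cw_def algebra_simps)
    ultimately show ?thesis
      by (simp add: Tr_add)
  qed
  then have "walsh (a + a') (b + b') (c + c') = (if h + h' = 0 then 2 ^ m else - (2 ^ m))"
    by (simp add: walsh_def chi_def card_field)
  then have "(walsh (a + a') (b + b') (c + c'))\<^sup>2 = (2 ^ m)\<^sup>2"
    by auto
  then have "a = a'" "b = b'" "c = c'"
    using walsh_square_eq_max[OF assms(1,2)] by (auto simp: add_eq_0_iff_eq)
  with fun_cong[OF assms(3), of 0] show ?thesis
    by (simp add: A A' word_def)
qed

text \<open>Weight \<open>i\<close> means \<open>walsh = v\<close> for \<open>h = 0\<close> and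
  \<open>walsh = - v\<close> for \<open>h = 1\<close>, where \<open>v = 2 ^ m - 2 * i\<close>.
  Together these are the triples with square \<open>v\<^sup>2\<close>; for \<open>v = 0\<close> the
  two sets coincide and each triple counts twice.\<close>

lemma card_weight:
  assumes "even m" and "m \<ge> 6"
  shows "int (card {w \<in> trace_code m. hamming_weight (w :: 'a \<Rightarrow> 'a) = i})
    = (if 2 * int i = 2 ^ m then 2 else 1) * count_walsh_square ((2 ^ m - 2 * int i)\<^sup>2)"
proof -
  define V where "V v = {(a, b, c). walsh a b c = v}" for v
  let ?v = "2 ^ m - 2 * int i"
  have w0: "hamming_weight (word A 0) = i \<longleftrightarrow> A \<in> V ?v" for A
  proof (cases A)
    case (fields a b c)
    then show ?thesis
      using weight_word[of 0 a b c] by (auto simp: V_def)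
  qed
  have w1: "hamming_weight (word A 1) = i \<longleftrightarrow> A \<in> V (- ?v)" for A
  proof (cases A)
    case (fields a b c)
    then show ?thesis
      using weight_word[of 1 a b c] by (auto simp: V_def)
  qed
  have "{w \<in> trace_code m. hamming_weight w = i}
      = (\<lambda>A. word A 0) ` {A. hamming_weight (word A 0) = i}
        \<union> (\<lambda>A. word A 1) ` {A. hamming_weight (word A 1) = i}"
    unfolding trace_code_eq by auto
  also have "\<dots> = (\<lambda>A. word A 0) ` V ?v \<union> (\<lambda>A. word A 1) ` V (- ?v)"
    unfolding w0 w1 by simp
  also have "card \<dots> = card ((\<lambda>A. word A 0) ` V ?v) + card ((\<lambda>A. word A 1) ` V (- ?v))"
    by (rule card_Un_disjoint) (auto dest: word_inj[OF assms])
  also have "\<dots> = card (V ?v) + card (V (- ?v))"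
    using word_inj[OF assms] by (simp add: card_image inj_on_def)
  finally have sum: "card {w \<in> trace_code m. hamming_weight (w :: 'a \<Rightarrow> 'a) = i} = card (V ?v) + card (V (- ?v))" .
  have union: "{(a, b, c). (walsh a b c)\<^sup>2 = ?v\<^sup>2} = V ?v \<union> V (- ?v)"
    by (auto simp: V_def power2_eq_iff)
  show ?thesis
  proof (cases "?v = 0")
    case True
    then show ?thesis
      using sum union by (simp add: count_walsh_square_def)
  next
    case False
    then have "V ?v \<inter> V (- ?v) = {}"
      by (auto simp: V_def)
    then show ?thesis
      using False by (simp add: sum union count_walsh_square_def card_Un_disjoint)
  qed
qed

text \<open>A \<open>2\<close>-design needs block size at least 2, so weight 1 must be
  excluded.\<close>

lemma weight_bounds:
  assumes "even m" and "m \<ge> 6" and "w \<in> trace_code m" and "hamming_weight (w :: 'a \<Rightarrow> 'a) \<ge> 1"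
  shows "2 \<le> hamming_weight w" and "hamming_weight w \<le> 2 ^ m"
proof -
  obtain a b c h where w: "w = word (a, b, c) h" and h: "h \<in> {0, 1}"
    using assms(3) unfolding trace_code_eq by auto
  define Q :: int where "Q = 2 ^ m"
  have "(2::int) ^ 6 \<le> Q"
    unfolding Q_def using assms(2) by (intro power_increasing) auto
  then have Q: "Q \<ge> 64"
    by simp
  have "hamming_weight w \<noteq> 1"
  proof
    assume "hamming_weight w = 1"
    then have "walsh a b c = Q - 2 \<or> walsh a b c = - (Q - 2)"
      using weight_word[OF h, of a b c] by (auto simp: w Q_def split: if_splits)
    then have "(walsh a b c)\<^sup>2 = (Q - 2)\<^sup>2"
      by (simp only: power2_eq_iff)
    then have "(Q - 2)\<^sup>2 \<in> {0, Q, 4 * Q, 16 * Q, Q\<^sup>2}"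
      using walsh_square_range[OF assms(1), of a b c] by (simp add: Q_def)
    \<comment> \<open>Hence \<open>(Q - 2)\<^sup>2\<close> lies strictly between
      \<open>16 * Q\<close> and \<open>Q\<^sup>2\<close>, and is none of the possible
      values.\<close>
    moreover have "Q * Q \<ge> 64 * Q"
      using Q by simp
    ultimately show False
      using Q by (auto simp: power2_eq_square algebra_simps)
  qed
  with assms(4) show "2 \<le> hamming_weight w"
    by simp
  show "hamming_weight w \<le> 2 ^ m"
    unfolding hamming_weight_def card_field[symmetric] by (rule card_mono) auto
qed

subsection \<open>Affine invariance and designs\<close>

text \<open>The substitution creates terms in \<open>x ^ 4\<close> and \<open>x\<^sup>2\<close>.
  Their coefficients have a fourth root \<open>d\<close> and a square root \<open>e\<close>, so
  under the trace they become the linear terms \<open>d * x\<close> and \<open>e * x\<close>; the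
  trace of the constant term goes into \<open>h\<close>.\<close>

lemma trace_code_affine:
  fixes w :: "'a \<Rightarrow> 'a"
  assumes "w \<in> trace_code m"
  shows "(\<lambda>x. w (u * x + v)) \<in> trace_code m"
proof -
  obtain a b c h where w: "w = word (a, b, c) h" and h: "h \<in> {0, 1}"
    using assms unfolding trace_code_eq by auto
  obtain d where d: "d ^ 4 = a * u ^ 4 * v"
    using ex_root[of 2] by auto
  obtain e where e: "e\<^sup>2 = b * u\<^sup>2 * v"
    using ex_root[of 1] by auto
  define c' where "c' = d + a * u * v ^ 4 + e + b * u * v\<^sup>2 + c * u"
  have "w (u * x + v) = word (a * u ^ 5, b * u ^ 3, c') (Tr (cw a b c v) + h) x" for x
  proof -
    have "cw a b c (u * x + v) = a * u ^ 5 * x ^ 5 + b * u ^ 3 * x ^ 3 + cw a b c v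
        + (a * u ^ 4 * v) * x ^ 4 + (b * u\<^sup>2 * v) * x\<^sup>2 + (a * u * v ^ 4 + b * u * v\<^sup>2 + c * u) * x"
      by (simp add: cw_def add_power3 add_power5 power_mult_distrib algebra_simps)
    also have "(a * u ^ 4 * v) * x ^ 4 = (d * x) ^ 4"
      by (simp add: power_mult_distrib d)
    also have "(b * u\<^sup>2 * v) * x\<^sup>2 = (e * x)\<^sup>2"
      by (simp add: power_mult_distrib e)
    finally have "Tr (cw a b c (u * x + v)) = Tr (a * u ^ 5 * x ^ 5 + b * u ^ 3 * x ^ 3)
        + Tr (cw a b c v) + Tr (d * x) + Tr (e * x) + Tr ((a * u * v ^ 4 + b * u * v\<^sup>2 + c * u) * x)"
      by (simp only: Tr_add Tr_square Tr_power4)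
    also have "\<dots> = Tr (cw (a * u ^ 5) (b * u ^ 3) c' x) + Tr (cw a b c v)"
      by (simp add: cw_def c'_def Tr_add algebra_simps)
    finally show ?thesis
      by (simp add: w word_def add_ac)
  qed
  moreover have "Tr (cw a b c v) + h \<in> {0, 1}"
    using Tr_01[of "cw a b c v"] h by auto
  ultimately show ?thesis
    unfolding trace_code_eq by blast
qed

lemma hamming_weight_affine:
  assumes "u \<noteq> (0::'a)"
  shows "hamming_weight (\<lambda>x. w (u * x + v)) = hamming_weight w"
  unfolding hamming_weight_def
  using assms
  by (intro bij_betw_same_card[of "\<lambda>x. u * x + v"] bij_betw_byWitness[where f' = "\<lambda>y. (y - v) / u"]) auto

section \<open>Codewords that are nonzero at two given positions\<close>

definition pair_count :: "nat \<Rightarrow> 'a \<Rightarrow> 'a \<Rightarrow> nat" where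
  "pair_count i x y = card {w \<in> trace_code m. hamming_weight w = i \<and> w x \<noteq> 0 \<and> w y \<noteq> 0}"

text \<open>Composition with \<open>t \<mapsto> (y - x) * t + x\<close>, which sends 0 to
  \<open>x\<close> and 1 to \<open>y\<close>, is a weight-preserving bijection of the code;
  \<open>?g\<close> composes with the inverse map.\<close>

lemma pair_count_const:
  assumes "x \<noteq> y"
  shows "pair_count i x y = pair_count i 0 1"
  unfolding pair_count_def
proof (rule bij_betw_same_card)
  let ?S = "\<lambda>x y. {w \<in> trace_code m. hamming_weight (w :: 'a \<Rightarrow> 'a) = i \<and> w x \<noteq> 0 \<and> w y \<noteq> 0}"
  define d where "d = y - x"
  then have d: "d \<noteq> 0" "d + x = y"
    using assms by simp_all
  let ?f = "\<lambda>w t. w (d * t + x)"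
  let ?g = "\<lambda>w t. w (inverse d * t + - x / d)"
  have fg: "d * (inverse d * t + - x / d) + x = t" for t
    using d(1) by (simp add: right_diff_distrib flip: mult.assoc)
  have gf: "inverse d * (d * t + x) + - x / d = t" for t
    using d(1) by (simp add: distrib_left divide_inverse mult.commute flip: mult.assoc)
  have gx: "inverse d * x + - x / d = 0"
    using d(1) by (simp add: divide_inverse mult.commute)
  have gy: "inverse d * y + - x / d = 1"
    using d(1) by (simp add: distrib_left divide_inverse mult.commute flip: d(2))
  show "bij_betw ?f (?S x y) (?S 0 1)"
  proof (rule bij_betw_byWitness[where f' = ?g])
    show "?f ` ?S x y \<subseteq> ?S 0 1"
      using d by (auto simp: trace_code_affine hamming_weight_affine)
    show "?g ` ?S 0 1 \<subseteq> ?S x y"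
    proof
      fix w
      assume "w \<in> ?g ` ?S 0 1"
      then obtain v where v: "v \<in> ?S 0 1" and w: "w = ?g v"
        by blast
      have "w \<in> trace_code m"
        unfolding w using v by (intro trace_code_affine) simp
      moreover have "hamming_weight w = i"
        unfolding w using v d(1) by (subst hamming_weight_affine) auto
      moreover have "w x = v 0" "w y = v 1"
        unfolding w gx gy by simp_all
      ultimately show "w \<in> ?S x y"
        using v by simp
    qed
  qed (auto simp only: fg gf)
qed

text \<open>Count incidences between codewords of weight \<open>i\<close> and ordered pairs of
  distinct positions in their supports.\<close>

lemma pair_count_double_counting:
  "pair_count i 0 1 * (2 ^ m * (2 ^ m - 1))
    = card {w \<in> trace_code m. hamming_weight (w :: 'a \<Rightarrow> 'a) = i} * (i * (i - 1))"
proof -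
  let ?S = "{w \<in> trace_code m. hamming_weight (w :: 'a \<Rightarrow> 'a) = i}"
  have off: "card (SIGMA x:A. A - {x}) = card A * (card A - 1)" for A :: "'a set"
    by (simp add: card_Diff_singleton)
  let ?U = "SIGMA x:UNIV. (UNIV :: 'a set) - {x}"
  let ?R = "\<lambda>p w. w (fst p) \<noteq> 0 \<and> w (snd p) \<noteq> (0::'a)"
  have "(\<Sum>p\<in>?U. card {w \<in> ?S. ?R p w}) = (i * (i - 1)) * card ?S"
  proof (rule sum_multicount)
    show "\<forall>w\<in>?S. card {p \<in> ?U. ?R p w} = i * (i - 1)"
    proof
      fix w
      assume w: "w \<in> ?S"
      have "{p \<in> ?U. ?R p w} = (SIGMA x:{x. w x \<noteq> 0}. {x. w x \<noteq> 0} - {x})"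
        by auto
      with w off[of "{x. w x \<noteq> 0}"] show "card {p \<in> ?U. ?R p w} = i * (i - 1)"
        by (simp add: hamming_weight_def)
    qed
  qed auto
  moreover have "(\<Sum>p\<in>?U. card {w \<in> ?S. ?R p w}) = (\<Sum>p\<in>?U. pair_count i 0 1)"
  proof (rule sum.cong[OF refl])
    fix p
    assume "p \<in> ?U"
    then have "pair_count i (fst p) (snd p) = pair_count i 0 1"
      by (intro pair_count_const) auto
    moreover have "{w \<in> ?S. ?R p w}
        = {w \<in> trace_code m. hamming_weight w = i \<and> w (fst p) \<noteq> 0 \<and> w (snd p) \<noteq> 0}"
      by auto
    ultimately show "card {w \<in> ?S. ?R p w} = pair_count i 0 1"
      by (simp only: pair_count_def)
  qed
  ultimately show ?thesis
    using off[of UNIV] by (simp add: card_field mult.commute)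
qed

lemma is_design_supports:
  assumes pos: "bij_betw pos (UNIV :: 'a set) {0..<2 ^ m}" and i: "2 \<le> i" "i \<le> 2 ^ m"
  shows "is_design 2 (2 ^ m) i (pair_count i 0 1) {0..<2 ^ m}
    (supports_of_weight pos (trace_code m :: ('a \<Rightarrow> 'a) set) i)"
  unfolding is_design_def
proof (intro conjI ballI allI impI)
  let ?B = "supports_of_weight pos (trace_code m :: ('a \<Rightarrow> 'a) set) i"
  have inj: "inj pos" and range: "range pos = {0..<2 ^ m}"
    using pos by (auto simp: bij_betw_def)
  show "b \<subseteq> {0..<2 ^ m}" if "b \<in> ?B" for b
    using that range by (auto simp: supports_of_weight_def codeword_support_def)
  show "card b = i" if "b \<in> ?B" for b
    using that inj
    by (auto simp: supports_of_weight_def codeword_support_def hamming_weight_def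
        intro!: card_image inj_on_subset[OF inj])
  show "card {b \<in> ?B. T \<subseteq> b} = pair_count i 0 1" if T: "T \<subseteq> {0..<2 ^ m} \<and> card T = 2" for T
  proof -
    obtain p r where "T = {p, r}" "p \<noteq> r"
      using T by (auto simp: card_2_iff)
    then obtain x y where xy: "T = {pos x, pos y}" "x \<noteq> y"
      using T range by (metis imageE insert_subset)
    let ?W = "{w \<in> trace_code m. hamming_weight (w :: 'a \<Rightarrow> 'a) = i \<and> w x \<noteq> 0 \<and> w y \<noteq> 0}"
    have "T \<subseteq> codeword_support pos w \<longleftrightarrow> w x \<noteq> 0 \<and> w y \<noteq> 0" for w :: "'a \<Rightarrow> 'a"
      by (simp add: codeword_support_def xy inj_image_mem_iff[OF inj])
    then have "{b \<in> ?B. T \<subseteq> b} = codeword_support pos ` ?W"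
      unfolding supports_of_weight_def by blast
    \<comment> \<open>A word with values in \<open>{0, 1}\<close> is determined by its support, so
      counting blocks is the same as counting codewords.\<close>
    moreover have "inj_on (codeword_support pos) ?W"
    proof (rule inj_onI)
      fix w w'
      assume w: "w \<in> ?W" "w' \<in> ?W" and eq: "codeword_support pos w = codeword_support pos w'"
      have "w z \<noteq> 0 \<longleftrightarrow> w' z \<noteq> 0" for z
        using eq by (auto simp: codeword_support_def inj_image_eq_iff[OF inj])
      moreover have "w z \<in> {0, 1}" "w' z \<in> {0, 1}" for z
        using w trace_code_values by blast+
      ultimately show "w = w'"
        by (intro ext) (metis empty_iff insert_iff)
    qed
    ultimately show ?thesis
      using pair_count_const[OF xy(2), of i] by (simp add: card_image pair_count_def)
  qed
qed (use i in auto)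

end

section \<open>Evaluation of the design parameters\<close>

theorem theorem5:
  fixes s m :: nat
    and pos :: "'a::{field, finite} \<Rightarrow> nat"
    and C :: "('a \<Rightarrow> 'a) set"
  assumes "s \<ge> 3"
    and "m = 2 * s"
    and "CARD('a) = 2 ^ m"
    and "bij_betw pos (UNIV :: 'a set) {0..<2 ^ m}"
    and "C = trace_code m"
  shows "(\<forall>i\<ge>1. (\<exists>w\<in>C. hamming_weight w = i) \<longrightarrow>
            is_t_design 2 {0..<2 ^ m} (supports_of_weight pos C i)) \<and>
         (\<forall>(i :: nat, r :: real) \<in>
           {(2 ^ (2*s-1),
             (29 * 2 ^ (6*s-6) - 33 * 2 ^ (4*s-6) + 17 * 2 ^ (2*s-4) - 1) * (2 ^ (2*s-1) - 1)
               / (2 ^ (2*s) - 1)),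
            (2 ^ (2*s-1) - 2 ^ (s-1),
             2/15 * (2 ^ (s-1) * (3 * 2 ^ (4*s) + 5 * 2 ^ (2*s) - 8) * (2 ^ (2*s-1) - 2 ^ (s-1) - 1)
               / (2 ^ s + 1))),
            (2 ^ (2*s-1) + 2 ^ (s-1),
             2/15 * (2 ^ (s-1) * (3 * 2 ^ (4*s) + 5 * 2 ^ (2*s) - 8) * (2 ^ (2*s-1) + 2 ^ (s-1) - 1)
               / (2 ^ s - 1))),
            (2 ^ (2*s-1) - 2 ^ s,
             7/3 * 2 ^ (3*s-4) * (2 ^ (2*s-1) - 2 ^ s - 1) * (2 ^ (s-1) - 1)),
            (2 ^ (2*s-1) + 2 ^ s,
             7/3 * 2 ^ (3*s-4) * (2 ^ (2*s-1) + 2 ^ s - 1) * (2 ^ (s-1) + 1)),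
            (2 ^ (2*s-1) - 2 ^ (s+1),
             1/15 * (2 ^ (s-3) * (2 ^ (4*s-2) - 5 * 2 ^ (2*s-2) + 1) * (2 ^ (2*s-1) - 2 ^ (s+1) - 1)
               * (2 ^ (s-2) - 1) / (2 ^ (2*s) - 1))),
            (2 ^ (2*s-1) + 2 ^ (s+1),
             1/15 * (2 ^ (s-3) * (2 ^ (4*s-2) - 5 * 2 ^ (2*s-2) + 1) * (2 ^ (2*s-1) + 2 ^ (s+1) - 1)
               * (2 ^ (s-2) + 1) / (2 ^ (2*s) - 1)))}.
           \<exists>l :: nat. real l = r \<and>
             is_design 2 (2 ^ m) i l {0..<2 ^ m} (supports_of_weight pos C i))"
proof -
  interpret binary_field m "TYPE('a)"
    by unfold_locales (fact assms(3))
  have m: "even m" "m \<ge> 6"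
    using assms(1,2) by auto
  \<comment> \<open>The smallest exponent in the statement is \<open>s - 3\<close>; in terms of
    \<open>t\<close> no truncated subtraction remains, and all quantities are polynomials or
    quotients of polynomials in \<open>u = 2 ^ t\<close>.\<close>
  obtain t where t: "s = t + 3"
    using assms(1) by (metis add.commute le_Suc_ex)
  define u :: real where "u = 2 ^ t"
  define un :: nat where "un = 2 ^ t"
  define q where "q = 64 * u\<^sup>2"
  have u: "u \<ge> 1" "un \<ge> 1"
    by (simp_all add: u_def un_def)
  have un: "real un = u"
    by (simp add: u_def un_def)
  have two_m: "(2::real) ^ m = q"
    by (simp add: q_def u_def assms(2) t power_add power_mult mult.commute flip: power_mult)
  have two_m_nat: "(2::nat) ^ m = 64 * un\<^sup>2"
    by (simp add: un_def assms(2) t power_add mult.commute flip: power_mult)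
  have two_m_int: "(2::int) ^ m = 64 * (int un)\<^sup>2"
    by (simp add: un_def assms(2) t power_add mult.commute flip: power_mult)
  have "u\<^sup>2 \<ge> 1"
    using u by simp
  then have q: "q \<ge> 64"
    by (simp add: q_def)
  let ?n = "\<lambda>v. real_of_int (count_walsh_square v)"
  note dist = walsh_square_distribution[OF m, THEN arg_cong[where f = real_of_int], simplified, unfolded two_m]
  \<comment> \<open>As \<open>q * (q - 1) \<noteq> 0\<close>, double counting determines the
    parameter; each case reduces to the identity assumed in \<open>r\<close>.\<close>
  have design: "\<exists>l::nat. real l = r \<and> is_design 2 (2 ^ m) i l {0..<2 ^ m} (supports_of_weight pos C i)"
    if i: "2 \<le> i" "i \<le> 2 ^ m"
      and r: "r * (q * (q - 1)) = (if 2 * i = 2 ^ m then 2 else 1)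
        * ?n ((2 ^ m - 2 * int i)\<^sup>2) * (real i * (real i - 1))"
    for i :: nat and r :: real
  proof (intro exI conjI)
    show "is_design 2 (2 ^ m) i (pair_count i 0 1) {0..<2 ^ m} (supports_of_weight pos C i)"
      unfolding assms(5) by (rule is_design_supports[OF assms(4) i])
    have "real (pair_count i 0 1 * (2 ^ m * (2 ^ m - 1)))
        = real (card {w \<in> trace_code m. hamming_weight (w :: 'a \<Rightarrow> 'a) = i} * (i * (i - 1)))"
      by (rule arg_cong[OF pair_count_double_counting])
    moreover have "real (card {w \<in> trace_code m. hamming_weight (w :: 'a \<Rightarrow> 'a) = i})
        = (if 2 * i = 2 ^ m then 2 else 1) * ?n ((2 ^ m - 2 * int i)\<^sup>2)"
    proof -
      have "2 * int i = 2 ^ m \<longleftrightarrow> 2 * i = 2 ^ m"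
        by (metis of_nat_eq_iff of_nat_mult of_nat_numeral of_nat_power)
      then show ?thesis
        using arg_cong[OF card_weight[OF m, of i], of real_of_int] by simp
    qed
    ultimately have "real (pair_count i 0 1) * (q * (q - 1)) = r * (q * (q - 1))"
      using i r two_m by (simp add: of_nat_diff)
    then show "real (pair_count i 0 1) = r"
      using q by simp
  qed
  have first: "is_t_design 2 {0..<2 ^ m} (supports_of_weight pos C i)"
    if "i \<ge> 1" "w \<in> C" "hamming_weight w = i" for i w
    using weight_bounds[OF m, of w] is_design_supports[OF assms(4), of i] that
    unfolding is_t_design_def assms(5) by auto
  let ?P = "\<lambda>i r. \<exists>l::nat. real l = r \<and>
    is_design 2 (2 ^ m) i l {0..<2 ^ m} (supports_of_weight pos C i)"
  have un_le: "un \<le> un\<^sup>2"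
    using u(2) by (simp add: power2_eq_square)
  have n0: "?n 0 = (q - 1) * (29 * q\<^sup>2 - 4 * q + 64) / 64"
    using dist(1) by simp
  have middle: "?P (32 * un\<^sup>2) r"
    if "r * (q * (q - 1)) = 2 * ((q - 1) * (29 * q\<^sup>2 - 4 * q + 64) / 64) * (32 * u\<^sup>2 * (32 * u\<^sup>2 - 1))" for r
  proof (rule design)
    show "2 \<le> 32 * un\<^sup>2" "32 * un\<^sup>2 \<le> 2 ^ m"
      using un_le u(2) by (simp_all add: two_m_nat)
    show "r * (q * (q - 1)) = (if 2 * (32 * un\<^sup>2) = 2 ^ m then 2 else 1)
        * ?n ((2 ^ m - 2 * int (32 * un\<^sup>2))\<^sup>2) * (real (32 * un\<^sup>2) * (real (32 * un\<^sup>2) - 1))"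
      unfolding that by (simp add: two_m_nat two_m_int un n0)
  qed
  \<comment> \<open>The weights \<open>q / 2 - k * u\<close> and \<open>q / 2 + k * u\<close> have
    squared \<open>walsh\<close> value \<open>4 * k\<^sup>2 * u\<^sup>2\<close>, which is
    \<open>q\<close>, \<open>4 * q\<close>, \<open>16 * q\<close> for
    \<open>k = 4, 8, 16\<close>.\<close>
  have sides: "?P (32 * un\<^sup>2 - k * un) r'" "?P (32 * un\<^sup>2 + k * un) r"
    if k: "k \<in> {4, 8, 16}" and n: "?n (4 * (int k)\<^sup>2 * (int un)\<^sup>2) = n"
      and r: "r' * (q * (q - 1)) = n * ((32 * u\<^sup>2 - k * u) * (32 * u\<^sup>2 - k * u - 1))"
        "r * (q * (q - 1)) = n * ((32 * u\<^sup>2 + k * u) * (32 * u\<^sup>2 + k * u - 1))"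
    for k :: nat and r r' n :: real
  proof -
    \<comment> \<open>The bound keeps the subtraction of naturals exact and the smaller weight at
      least 2.\<close>
    have le: "k * un \<le> 16 * un\<^sup>2" and pos: "k * un \<ge> 1"
      using k un_le u(2) by (auto intro: order.trans)
    have *: "2 * (32 * un\<^sup>2 - k * un) \<noteq> 2 ^ m" "2 * (32 * un\<^sup>2 + k * un) \<noteq> 2 ^ m"
      using le pos unfolding two_m_nat by (linarith, simp)
    have ints: "int (32 * un\<^sup>2 - k * un) = 32 * (int un)\<^sup>2 - int k * int un"
      "real (32 * un\<^sup>2 - k * un) = 32 * u\<^sup>2 - k * u" "real (32 * un\<^sup>2 + k * un) = 32 * u\<^sup>2 + k * u"
      using le by (simp_all add: of_nat_diff un)
    have v: "(2 ^ m - 2 * int (32 * un\<^sup>2 - k * un))\<^sup>2 = 4 * (int k)\<^sup>2 * (int un)\<^sup>2"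
      "(2 ^ m - 2 * int (32 * un\<^sup>2 + k * un))\<^sup>2 = 4 * (int k)\<^sup>2 * (int un)\<^sup>2"
      unfolding ints(1) two_m_int by (simp_all add: power2_eq_square algebra_simps)
    show "?P (32 * un\<^sup>2 - k * un) r'"
    proof (rule design)
      show "2 \<le> 32 * un\<^sup>2 - k * un" "32 * un\<^sup>2 - k * un \<le> 2 ^ m"
        using le un_le u(2) unfolding two_m_nat by linarith+
    qed (simp only: * v n r ints(2) if_False mult_1)
    show "?P (32 * un\<^sup>2 + k * un) r"
    proof (rule design)
      show "2 \<le> 32 * un\<^sup>2 + k * un" "32 * un\<^sup>2 + k * un \<le> 2 ^ m"
        using le un_le u(2) unfolding two_m_nat by linarith+
    qed (simp only: * v n r ints(3) if_False mult_1)
  qed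
  have n4: "?n (4 * (int 4)\<^sup>2 * (int un)\<^sup>2) = 2 * q * (q - 1) * (3 * q + 8) / 15"
    using dist(2) by (simp add: two_m_int)
  have n8: "?n (4 * (int 8)\<^sup>2 * (int un)\<^sup>2) = 7 * q\<^sup>2 * (q - 1) / 48"
    using dist(3) by (simp add: two_m_int)
  have n16: "?n (4 * (int 16)\<^sup>2 * (int un)\<^sup>2) = q * (q - 1) * (q - 4) / 960"
    using dist(4) by (simp add: two_m_int)
  have pw: "(2::real) ^ (k * t + c) = 2 ^ c * u ^ k" "(2::nat) ^ (k * t + c) = 2 ^ c * un ^ k" for k c
    by (simp_all add: u_def un_def power_add mult.commute flip: power_mult)
  \<comment> \<open>The forms \<open>1 * t\<close> and \<open>+ 0\<close> are kept so that every
    right-hand side matches the pattern of \<open>pw\<close>.\<close>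
  have exps: "2 * s - 1 = 2 * t + 5" "6 * s - 6 = 6 * t + 12" "4 * s - 6 = 4 * t + 6"
    "2 * s - 4 = 2 * t + 2" "2 * s = 2 * t + 6" "s - 1 = 1 * t + 2" "4 * s = 4 * t + 12"
    "s = 1 * t + 3" "3 * s - 4 = 3 * t + 5" "s + 1 = 1 * t + 4" "s - 3 = 1 * t + 0"
    "4 * s - 2 = 4 * t + 10" "2 * s - 2 = 2 * t + 4" "s - 2 = 1 * t + 1"
    by (simp_all add: t)
  have real_powers: "(2::real) ^ (2 * s - 1) = 32 * u\<^sup>2" "(2::real) ^ (6 * s - 6) = 4096 * u ^ 6"
    "(2::real) ^ (4 * s - 6) = 64 * u ^ 4" "(2::real) ^ (2 * s - 4) = 4 * u\<^sup>2"
    "(2::real) ^ (2 * s) = 64 * u\<^sup>2" "(2::real) ^ (s - 1) = 4 * u" "(2::real) ^ (4 * s) = 4096 * u ^ 4"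
    "(2::real) ^ s = 8 * u" "(2::real) ^ (3 * s - 4) = 32 * u ^ 3" "(2::real) ^ (s + 1) = 16 * u"
    "(2::real) ^ (s - 3) = u" "(2::real) ^ (4 * s - 2) = 1024 * u ^ 4"
    "(2::real) ^ (2 * s - 2) = 16 * u\<^sup>2" "(2::real) ^ (s - 2) = 2 * u"
    by (subst exps, subst pw, simp)+
  have nat_powers: "(2::nat) ^ (2 * s - 1) = 32 * un\<^sup>2" "(2::nat) ^ (s - 1) = 4 * un"
    "(2::nat) ^ s = 8 * un" "(2::nat) ^ (s + 1) = 16 * un"
    by (subst exps, subst pw, simp)+
  have nz: "64 * u\<^sup>2 - 1 \<noteq> 0" "8 * u + 1 \<noteq> 0" "8 * u - 1 \<noteq> 0"
    using \<open>u\<^sup>2 \<ge> 1\<close> u(1) by linarith+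
  \<comment> \<open>The first factor is the expansion of the count in \<open>n0\<close>.\<close>
  have d0: "?P (32 * un\<^sup>2) ((29 * (4096 * u ^ 6) - 33 * (64 * u ^ 4) + 17 * (4 * u\<^sup>2) - 1)
      * (32 * u\<^sup>2 - 1) / (64 * u\<^sup>2 - 1))"
    by (rule middle) (use nz(1) in \<open>simp add: q_def field_simps; algebra\<close>)
  let ?a4 = "2/15 * (4 * u * (3 * (4096 * u ^ 4) + 5 * (64 * u\<^sup>2) - 8) * (32 * u\<^sup>2 - 4 * u - 1) / (8 * u + 1))"
  let ?b4 = "2/15 * (4 * u * (3 * (4096 * u ^ 4) + 5 * (64 * u\<^sup>2) - 8) * (32 * u\<^sup>2 + 4 * u - 1) / (8 * u - 1))"
  \<comment> \<open>The long factor is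
    \<open>3 * q\<^sup>2 + 5 * q - 8 = (3 * q + 8) * (q - 1)\<close>, and
    \<open>q - 1 = (8 * u - 1) * (8 * u + 1)\<close> accounts for the denominators.\<close>
  have e4: "?a4 * (q * (q - 1)) = 2 * q * (q - 1) * (3 * q + 8) / 15 * ((32 * u\<^sup>2 - real 4 * u) * (32 * u\<^sup>2 - real 4 * u - 1))"
    "?b4 * (q * (q - 1)) = 2 * q * (q - 1) * (3 * q + 8) / 15 * ((32 * u\<^sup>2 + real 4 * u) * (32 * u\<^sup>2 + real 4 * u - 1))"
    using nz by (simp add: q_def field_simps; algebra)+
  have d4: "?P (32 * un\<^sup>2 - 4 * un) ?a4" "?P (32 * un\<^sup>2 + 4 * un) ?b4"
    using sides[OF _ n4 e4] by simp_all
  let ?a8 = "7/3 * (32 * u ^ 3) * (32 * u\<^sup>2 - 8 * u - 1) * (4 * u - 1)"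
  let ?b8 = "7/3 * (32 * u ^ 3) * (32 * u\<^sup>2 + 8 * u - 1) * (4 * u + 1)"
  have e8: "?a8 * (q * (q - 1)) = 7 * q\<^sup>2 * (q - 1) / 48 * ((32 * u\<^sup>2 - real 8 * u) * (32 * u\<^sup>2 - real 8 * u - 1))"
    "?b8 * (q * (q - 1)) = 7 * q\<^sup>2 * (q - 1) / 48 * ((32 * u\<^sup>2 + real 8 * u) * (32 * u\<^sup>2 + real 8 * u - 1))"
    using nz by (simp add: q_def field_simps; algebra)+
  have d8: "?P (32 * un\<^sup>2 - 8 * un) ?a8" "?P (32 * un\<^sup>2 + 8 * un) ?b8"
    using sides[OF _ n8 e8] by simp_all
  let ?a16 = "1/15 * (u * (1024 * u ^ 4 - 5 * (16 * u\<^sup>2) + 1) * (32 * u\<^sup>2 - 16 * u - 1) * (2 * u - 1)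
      / (64 * u\<^sup>2 - 1))"
  let ?b16 = "1/15 * (u * (1024 * u ^ 4 - 5 * (16 * u\<^sup>2) + 1) * (32 * u\<^sup>2 + 16 * u - 1) * (2 * u + 1)
      / (64 * u\<^sup>2 - 1))"
  \<comment> \<open>Here the quartic factor is \<open>(q - 1) * (q - 4) / 4\<close>.\<close>
  have e16: "?a16 * (q * (q - 1)) = q * (q - 1) * (q - 4) / 960 * ((32 * u\<^sup>2 - real 16 * u) * (32 * u\<^sup>2 - real 16 * u - 1))"
    "?b16 * (q * (q - 1)) = q * (q - 1) * (q - 4) / 960 * ((32 * u\<^sup>2 + real 16 * u) * (32 * u\<^sup>2 + real 16 * u - 1))"
    using nz by (simp add: q_def field_simps; algebra)+
  have d16: "?P (32 * un\<^sup>2 - 16 * un) ?a16" "?P (32 * un\<^sup>2 + 16 * un) ?b16"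
    using sides[OF _ n16 e16] by simp_all
  show ?thesis
    unfolding real_powers nat_powers
    by (simp only: Set.ball_simps prod.case) (use first d0 d4 d8 d16 in blast)
qed

end
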